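(* Let $T\ge1$ be the time horizon and let $K_T$ be the total number of policy switches made by LPSRL (context) up to time $T$. Then $$K_T\le\log_2T+1 .$$
   Context: LPSRL (Langevin Posterior Sampling for RL) uses a static doubling scheme: for $k=1,2,\dots$, the $k$-th policy switch takes place at time $t_k=2^{k-1}$, and the resulting policy is followed for $T_k=2^{k-1}$ time steps, i.e. for times $t_k,\dots,t_k+T_k-1$ (stopping at time $T$). $K_T$ counts the switches with $t_k\le T$. *)

theory Defs
  imports Complex_Main
begin

text \<open>The static doubling scheme. Policies are numbered from \<open>k = 1\<close>; the value of the
  functions below at \<open>k = 0\<close> is never used.\<close>

definition switch_time :: "nat \<Rightarrow> nat" where
  "switch_time k = 2 ^ (k - 1)"

definition episode_length :: "nat \<Rightarrow> nat" where
  "episode_length k = 2 ^ (k - 1)"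

text \<open>The policy chosen at the \<open>k\<close>-th switch is followed for exactly \<open>episode_length k\<close> steps,
  until the next switch.\<close>

lemma switch_time_1: "switch_time 1 = 1"
  by (simp add: switch_time_def)

lemma switch_time_Suc:
  assumes "k \<ge> 1"
  shows "switch_time (Suc k) = switch_time k + episode_length k"
  using assms by (cases k) (simp_all add: switch_time_def episode_length_def)

definition switches_upto :: "nat \<Rightarrow> nat set" where
  "switches_upto T = {k. k \<ge> 1 \<and> switch_time k \<le> T}"

definition num_switches :: "nat \<Rightarrow> nat" where
  "num_switches T = card (switches_upto T)"

text \<open>The cardinality above is a genuine count, since the set is finite.\<close>

lemma finite_switches_upto: "finite (switches_upto T)"
proof (rule finite_subset)
  show "switches_upto T \<subseteq> {..T}"
  proof
    fix k assume "k \<in> switches_upto T"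
    then have "k \<ge> 1" and "2 ^ (k - 1) \<le> T"
      by (auto simp: switches_upto_def switch_time_def)
    moreover have "k - 1 < (2::nat) ^ (k - 1)"
      by (rule less_exp)
    ultimately have "k \<le> T"
      by linarith
    then show "k \<in> {..T}"
      by simp
  qed
qed simp

end

theory Submission imports Defs begin

text \<open>Switch times double, so the index \<open>m\<close> of the last switch up to
  \<open>T\<close> satisfies \<open>2 ^ (m - 1) \<le> T\<close>, and logarithms bound
  \<open>m - 1\<close>. Indices start at 1, so at most \<open>m\<close> switches are
  counted.\<close>

theorem theorem8:
  fixes T :: nat
  assumes "T \<ge> 1"
  shows "real (num_switches T) \<le> log 2 (real T) + 1"
proof -
  define m where "m = Max (switches_upto T)"
  \<comment> \<open>Nonemptiness, from \<open>T \<ge> 1\<close>, ensures that \<open>Max\<close> is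
    attained.\<close>
  have "1 \<in> switches_upto T"
    using assms by (simp add: switches_upto_def switch_time_1[unfolded One_nat_def])
  then have "m \<in> switches_upto T"
    unfolding m_def using Max_in finite_switches_upto by blast
  then have m: "m \<ge> 1" "2 ^ (m - 1) \<le> T"
    by (auto simp: switches_upto_def switch_time_def)
  have "switches_upto T \<subseteq> {1..m}"
    unfolding m_def using Max_ge[OF finite_switches_upto] by (auto simp: switches_upto_def)
  then have "num_switches T \<le> m"
    unfolding num_switches_def using card_mono[of "{1..m}"] by fastforce
  moreover have "real (m - 1) \<le> log 2 (real T)"
    using m(2) by (rule le_log2_of_power)
  \<comment> \<open>Since \<open>m \<ge> 1\<close>, the truncated \<open>m - 1\<close> is a true
    difference.\<close>
  ultimately show ?thesis
    using m(1) by linarith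
qed

end
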